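(* Let $\Omega\subset\mathbb{R}^2$ be a bounded polygonal domain and let $\{\mathcal{T}_h\}$ be a quasi-uniform family of triangulations of $\Omega$ with characteristic element diameter $h>0$. Let $K$ and $\bar K_{\mathrm{ES}}$ be the stiffness matrices on $V_h$ of the standard finite element method and of the edge-based smoothed finite element method (ES-FEM), respectively, as defined in the context. Then $K$ and $\bar K_{\mathrm{ES}}$ are spectrally equivalent: there exist two positive constants $\underline{C}$ and $\overline{C}$, independent of the mesh size $h$, such that $$\underline{C}\,u^TKu\le u^T\bar K_{\mathrm{ES}}u\le \overline{C}\,u^TKu\qquad\forall u\in V_h .$$
   Context: Triangulations are conforming; quasi-uniform means shape-regular with all element diameters comparable to $h$, with constants independent of $h$. For $n\ge 0$, $\mathcal{P}_n(\omega)$ is the set of polynomials of degree at most $n$ on $\omega$. $V_h=\{v\in H_0^1(\Omega): v|_e\in\mathcal{P}_1(e)\ \forall e\in\mathcal{T}_h\}$. Functions in $V_h$ are identified with their vectors of nodal degrees of freedom. Standard stiffness matrix: $u^TKv=\int_\Omega\nabla u\cdot\nabla v\,d\Omega$ for $u,v\in V_h$. ES-FEM: each element $e\in\mathcal{T}_h$ is divided into three triangles by joining its barycenter to its vertices, so each of these triangles corresponds to one edge of $e$. For each edge of $\mathcal{T}_h$, the associated smoothing domain $s$ is the union of the sub-triangles corresponding to that edge (two sub-triangles, belonging to the two elements sharing the edge, for an interior edge; one sub-triangle for a boundary edge). Let $\mathcal{S}_{h,\mathrm{ES}}$ be the collection of all smoothing domains. For $u\in V_h$, the smoothed gradient $\bar\nabla_{\mathrm{ES}}u$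 is the piecewise constant vector field on $\mathcal{S}_{h,\mathrm{ES}}$ which, on the smoothing domain $s$ of an edge shared by elements $e^{(1)},e^{(2)}$, equals $$\frac{|e^{(1)}|\,\nabla u|_{e^{(1)}}+|e^{(2)}|\,\nabla u|_{e^{(2)}}}{|e^{(1)}|+|e^{(2)}|},$$ and which, on the smoothing domain of a boundary edge of an element $e$, equals $\nabla u|_e$. Here $|\cdot|$ denotes area. The ES-FEM stiffness matrix is given by $u^T\bar K_{\mathrm{ES}}v=\int_\Omega\bar\nabla_{\mathrm{ES}}u\cdot\bar\nabla_{\mathrm{ES}}v\,d\Omega$ for $u,v\in V_h$. *)

theory Defs
  imports "HOL-Analysis.Analysis"
begin

section \<open>The Sobolev space \<open>H\<^sup>1\<^sub>0\<close>\<close>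

text \<open>The pointwise gradient; its value is unspecified where \<open>f\<close> is not differentiable.\<close>

definition grad :: "('a::euclidean_space \<Rightarrow> real) \<Rightarrow> 'a \<Rightarrow> 'a" where
  "grad f x = (THE D. GDERIV f x :> D)"

fun C_k :: "nat \<Rightarrow> ('a::euclidean_space \<Rightarrow> real) \<Rightarrow> bool" where
  "C_k 0 f \<longleftrightarrow> continuous_on UNIV f"
| "C_k (Suc k) f \<longleftrightarrow>
     (\<exists>g. (\<forall>x. GDERIV f x :> g x) \<and> (\<forall>b\<in>Basis. C_k k (\<lambda>x. g x \<bullet> b)))"

definition test_functions :: "'a::euclidean_space set \<Rightarrow> ('a \<Rightarrow> real) set" where
  "test_functions \<Omega> =
     {\<phi>. (\<forall>k. C_k k \<phi>) \<and> compact (closure {x. \<phi> x \<noteq> 0}) \<and> closure {x. \<phi> x \<noteq> 0} \<subseteq> \<Omega>}"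

definition L2 :: "'a::euclidean_space set \<Rightarrow> ('a \<Rightarrow> 'b::euclidean_space) \<Rightarrow> bool" where
  "L2 \<Omega> f \<longleftrightarrow> set_borel_measurable lebesgue \<Omega> f \<and>
     set_integrable lebesgue \<Omega> (\<lambda>x. (norm (f x))\<^sup>2)"

definition weak_gradient ::
    "'a::euclidean_space set \<Rightarrow> ('a \<Rightarrow> real) \<Rightarrow> ('a \<Rightarrow> 'a) \<Rightarrow> bool" where
  "weak_gradient \<Omega> u g \<longleftrightarrow>
     (\<forall>\<phi>\<in>test_functions \<Omega>.
        (LINT x:\<Omega>|lebesgue. u x *\<^sub>R grad \<phi> x) = - (LINT x:\<Omega>|lebesgue. \<phi> x *\<^sub>R g x))"

text \<open>The closure of the test functions in the norm of \<open>H\<^sup>1\<close>. Elements are functions, not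
  classes modulo null sets, and their values outside \<open>\<Omega>\<close> are irrelevant.\<close>

definition H10 :: "'a::euclidean_space set \<Rightarrow> ('a \<Rightarrow> real) set" where
  "H10 \<Omega> = {u. \<exists>g. L2 \<Omega> u \<and> L2 \<Omega> g \<and> weak_gradient \<Omega> u g \<and>
     (\<exists>\<phi>. (\<forall>n::nat. \<phi> n \<in> test_functions \<Omega>) \<and>
        (\<lambda>n. (LINT x:\<Omega>|lebesgue. (\<phi> n x - u x)\<^sup>2)
           + (LINT x:\<Omega>|lebesgue. (norm (grad (\<phi> n) x - g x))\<^sup>2)) \<longlonglongrightarrow> 0)}"


section \<open>Polygonal domains and quasi-uniform triangulations\<close>

type_synonym plane = "real ^ 2"

text \<open>The condition \<open>interior (closure \<Omega>) = \<Omega>\<close> excludes slits; it holds for every Lipschitz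
  domain, but is weaker than the Lipschitz condition.\<close>

definition bounded_polygonal_domain :: "plane set \<Rightarrow> bool" where
  "bounded_polygonal_domain \<Omega> \<longleftrightarrow>
     open \<Omega> \<and> connected \<Omega> \<and> \<Omega> \<noteq> {} \<and> bounded \<Omega> \<and> interior (closure \<Omega>) = \<Omega> \<and>
     (\<exists>S. finite S \<and> frontier \<Omega> = (\<Union>(a, b)\<in>S. closed_segment a b))"

text \<open>Elements are closed nondegenerate triangles. Conformity is part of the library notion
  \<open>triangulation\<close>: two elements meet in a common face.\<close>

definition triangulation_of :: "plane set set \<Rightarrow> plane set \<Rightarrow> bool" where
  "triangulation_of \<T> \<Omega> \<longleftrightarrow>
     triangulation \<T> \<and> (\<forall>e\<in>\<T>. 2 simplex e) \<and> \<Union>\<T> = closure \<Omega>"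

definition shape_regular :: "real set \<Rightarrow> (real \<Rightarrow> plane set set) \<Rightarrow> bool" where
  "shape_regular H \<T> \<longleftrightarrow>
     (\<exists>\<sigma>>0. \<forall>h\<in>H. \<forall>e\<in>\<T> h. \<exists>z r. 0 < r \<and> cball z r \<subseteq> e \<and> diameter e \<le> \<sigma> * r)"

definition quasi_uniform :: "real set \<Rightarrow> (real \<Rightarrow> plane set set) \<Rightarrow> bool" where
  "quasi_uniform H \<T> \<longleftrightarrow> shape_regular H \<T> \<and>
     (\<exists>c>0. \<exists>C>0. \<forall>h\<in>H. \<forall>e\<in>\<T> h. c * h \<le> diameter e \<and> diameter e \<le> C * h)"


section \<open>The finite element space and the standard stiffness matrix\<close>

definition P1 :: "(plane \<Rightarrow> real) set" where
  "P1 = {p. \<exists>a c. \<forall>x. p x = a \<bullet> x + c}"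

text \<open>As the elements are closed, membership in \<open>V\<^sub>h\<close> selects from each class modulo null sets
  the representative with well-defined nodal values.\<close>

definition V\<^sub>h :: "plane set \<Rightarrow> plane set set \<Rightarrow> (plane \<Rightarrow> real) set" where
  "V\<^sub>h \<Omega> \<T> = {v \<in> H10 \<Omega>. \<forall>e\<in>\<T>. \<exists>p\<in>P1. \<forall>x\<in>e. v x = p x}"

text \<open>The degrees of freedom are the values at the interior vertices.\<close>

definition nodes :: "plane set \<Rightarrow> plane set set \<Rightarrow> plane set" where
  "nodes \<Omega> \<T> = {z \<in> \<Omega>. \<exists>e\<in>\<T>. z extreme_point_of e}"

text \<open>\<open>u\<^sup>T A v\<close> for a matrix \<open>A\<close> indexed by the nodes, with \<open>u\<close> and \<open>v\<close> identified with their
  vectors of nodal values.\<close>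

definition mat_form ::
    "plane set \<Rightarrow> plane set set \<Rightarrow> (plane \<Rightarrow> plane \<Rightarrow> real) \<Rightarrow> (plane \<Rightarrow> real) \<Rightarrow> (plane \<Rightarrow> real) \<Rightarrow> real"
  where
  "mat_form \<Omega> \<T> A u v = (\<Sum>y\<in>nodes \<Omega> \<T>. \<Sum>z\<in>nodes \<Omega> \<T>. u y * A y z * v z)"

text \<open>On \<open>V\<^sub>h\<close> the pointwise gradient exists off the element boundaries, which form a null set.\<close>

definition stiffness_matrix ::
    "plane set \<Rightarrow> plane set set \<Rightarrow> (plane \<Rightarrow> plane \<Rightarrow> real) \<Rightarrow> bool" where
  "stiffness_matrix \<Omega> \<T> K \<longleftrightarrow>
     (\<forall>u\<in>V\<^sub>h \<Omega> \<T>. \<forall>v\<in>V\<^sub>h \<Omega> \<T>.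
        mat_form \<Omega> \<T> K u v = (LINT x:\<Omega>|lebesgue. grad u x \<bullet> grad v x))"


section \<open>The edge-based smoothed finite element method\<close>

definition area :: "plane set \<Rightarrow> real" where
  "area S = measure lebesgue S"

definition barycenter :: "plane set \<Rightarrow> plane" where
  "barycenter e = (1/3) *\<^sub>R (\<Sum>z | z extreme_point_of e. z)"

definition edges :: "plane set set \<Rightarrow> plane set set" where
  "edges \<T> = {E. \<exists>e\<in>\<T>. E edge_of e}"

text \<open>The one or two elements having \<open>E\<close> as an edge.\<close>

definition elements_at :: "plane set set \<Rightarrow> plane set \<Rightarrow> plane set set" where
  "elements_at \<T> E = {e\<in>\<T>. E edge_of e}"

definition smoothing_domain :: "plane set set \<Rightarrow> plane set \<Rightarrow> plane set" where
  "smoothing_domain \<T> E = (\<Union>e\<in>elements_at \<T> E. convex hull (insert (barycenter e) E))"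

text \<open>The constant value of the gradient of \<open>u\<close> on \<open>e\<close>, for \<open>u\<close> affine on \<open>e\<close>.\<close>

definition grad_on :: "plane set \<Rightarrow> (plane \<Rightarrow> real) \<Rightarrow> plane" where
  "grad_on e u = (THE g. \<forall>x\<in>interior e. GDERIV u x :> g)"

text \<open>For a boundary edge there is a single summand, and the value is \<open>grad_on e u\<close>.\<close>

definition ES_value :: "plane set set \<Rightarrow> (plane \<Rightarrow> real) \<Rightarrow> plane set \<Rightarrow> plane" where
  "ES_value \<T> u E =
     (\<Sum>e\<in>elements_at \<T> E. area e *\<^sub>R grad_on e u) /\<^sub>R (\<Sum>e\<in>elements_at \<T> E. area e)"

text \<open>Interiors of distinct smoothing domains are disjoint, so at most one summand is nonzero;
  the field is set to zero on the null set not covered by these interiors.\<close>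

definition ES_grad :: "plane set set \<Rightarrow> (plane \<Rightarrow> real) \<Rightarrow> plane \<Rightarrow> plane" where
  "ES_grad \<T> u x =
     (\<Sum>E\<in>edges \<T>. indicator (interior (smoothing_domain \<T> E)) x *\<^sub>R ES_value \<T> u E)"

definition ES_stiffness_matrix ::
    "plane set \<Rightarrow> plane set set \<Rightarrow> (plane \<Rightarrow> plane \<Rightarrow> real) \<Rightarrow> bool" where
  "ES_stiffness_matrix \<Omega> \<T> K \<longleftrightarrow>
     (\<forall>u\<in>V\<^sub>h \<Omega> \<T>. \<forall>v\<in>V\<^sub>h \<Omega> \<T>.
        mat_form \<Omega> \<T> K u v = (LINT x:\<Omega>|lebesgue. ES_grad \<T> u x \<bullet> ES_grad \<T> v x))"

end

theory Submission
  imports Defs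
begin

text \<open>On an edge \<open>E\<close> the function \<open>u\<close> is single-valued, so the gradients of \<open>u\<close> on all elements
  containing \<open>E\<close> have the same tangential component, and so does their average, the smoothed
  gradient at \<open>E\<close>. Since two edge directions of an element \<open>e\<close> span the plane, the gradient of \<open>u\<close>
  on \<open>e\<close> is controlled by the smoothed gradients at two edges of \<open>e\<close>, with a constant depending only
  on the shape regularity. As each edge of \<open>e\<close> owns a third of the area of \<open>e\<close>, this is the lower
  bound. The upper bound is Jensen's inequality on each smoothing domain.\<close>

section \<open>Triangles\<close>

lemma two_simplexE:
  assumes "2 simplex e"
  obtains a b c where "\<not> affine_dependent {a, b, c}" "distinct [a, b, c]" "e = convex hull {a, b, c}"
proof -
  obtain C where C: "\<not> affine_dependent C" "int (card C) = 3" "e = convex hull C"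
    using assms by (auto simp: simplex_def)
  then have "card C = 3" by simp
  then obtain a b c where "C = {a, b, c}" "distinct [a, b, c]"
    by (auto simp: card_3_iff)
  then show thesis using C that by blast
qed

text \<open>Faces of a simplex are the hulls of subsets of its vertices, and affine independence
  makes the dimension of such a hull one less than the number of its vertices. Faces of dimension
  one thus come from pairs of vertices.\<close>

lemma edge_of_triangle_iff:
  fixes a b c :: "'a::euclidean_space"
  assumes ind: "\<not> affine_dependent {a, b, c}" and dist: "distinct [a, b, c]"
  shows "E edge_of convex hull {a, b, c} \<longleftrightarrow>
    E \<in> {closed_segment a b, closed_segment b c, closed_segment c a}"
proof -
  have indC: "\<not> affine_dependent C" if "C \<subseteq> {a, b, c}" for C
    using ind affine_dependent_subset that by blast
  have "card C = 2 \<longleftrightarrow> aff_dim (convex hull C) = 1" if "C \<subseteq> {a, b, c}" for C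
    using aff_dim_affine_independent [OF indC [OF that]] by (auto simp: aff_dim_convex_hull)
  then have "E edge_of convex hull {a, b, c} \<longleftrightarrow>
      (\<exists>C. C \<subseteq> {a, b, c} \<and> card C = 2 \<and> E = convex hull C)"
    unfolding edge_of_def face_of_convex_hull_affine_independent [OF ind] by metis
  also have "\<dots> \<longleftrightarrow> (\<exists>C. C \<in> {{a, b}, {b, c}, {c, a}} \<and> E = convex hull C)"
  proof -
    have "C \<subseteq> {a, b, c} \<and> card C = 2 \<longleftrightarrow> C \<in> {{a, b}, {b, c}, {c, a}}" for C
    proof
      assume "C \<subseteq> {a, b, c} \<and> card C = 2"
      then obtain x y where "C = {x, y}" "x \<noteq> y" "x \<in> {a, b, c}" "y \<in> {a, b, c}"
        by (metis card_2_iff insert_subset)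
      then show "C \<in> {{a, b}, {b, c}, {c, a}}"
        by (auto simp: doubleton_eq_iff)
    next
      assume "C \<in> {{a, b}, {b, c}, {c, a}}"
      then show "C \<subseteq> {a, b, c} \<and> card C = 2"
        using dist by auto
    qed
    then show ?thesis by metis
  qed
  also have "\<dots> \<longleftrightarrow> E \<in> {closed_segment a b, closed_segment b c, closed_segment c a}"
    unfolding segment_convex_hull by blast
  finally show ?thesis .
qed

lemma card_edges_of_triangle:
  fixes e :: "'a::euclidean_space set"
  assumes "2 simplex e"
  shows "card {E. E edge_of e} = 3"
proof -
  obtain a b c where abc: "\<not> affine_dependent {a, b, c}" "distinct [a, b, c]"
      "e = convex hull {a, b, c}"
    using two_simplexE [OF assms] .
  have "{E. E edge_of e} = {closed_segment a b, closed_segment b c, closed_segment c a}"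
    using edge_of_triangle_iff [OF abc(1,2)] abc(3) by auto
  also have "card \<dots> = 3"
  proof -
    have "closed_segment a b \<noteq> closed_segment b c" "closed_segment b c \<noteq> closed_segment c a"
      "closed_segment a b \<noteq> closed_segment c a"
      using abc(2) by (auto simp: closed_segment_eq doubleton_eq_iff)
    then show ?thesis by simp
  qed
  finally show ?thesis .
qed

text \<open>Two different edges of a triangle share a vertex. The labelling calls it
  \<open>b\<close>, so that the edges give two vectors based at \<open>b\<close>; the six cases are
  the ordered pairs of edges.\<close>

lemma two_edgesE:
  fixes e :: "'a::euclidean_space set"
  assumes "2 simplex e" "E edge_of e" "E' edge_of e" "E \<noteq> E'"
  obtains a b c where "\<not> affine_dependent {a, b, c}" "distinct [a, b, c]"
    "e = convex hull {a, b, c}" "E = closed_segment b a" "E' = closed_segment b c"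
proof -
  obtain a b c where abc: "\<not> affine_dependent {a, b, c}" "distinct [a, b, c]"
      "e = convex hull {a, b, c}"
    using two_simplexE [OF assms(1)] .
  \<comment> \<open>The hull does not depend on the order of the vertices, so they may be relabelled
    freely in each case.\<close>
  have perm: "\<not> affine_dependent {x, y, z}" "e = convex hull {x, y, z}"
    if "{x, y, z} = {a, b, c}" for x y z
    unfolding that using abc by simp_all
  have "E \<in> {closed_segment a b, closed_segment b c, closed_segment c a}"
    "E' \<in> {closed_segment a b, closed_segment b c, closed_segment c a}"
    using assms(2,3) unfolding abc(3) edge_of_triangle_iff [OF abc(1,2)] by -
  then consider "E = closed_segment a b" "E' = closed_segment b c"
    | "E = closed_segment b c" "E' = closed_segment a b"
    | "E = closed_segment b c" "E' = closed_segment c a"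
    | "E = closed_segment c a" "E' = closed_segment b c"
    | "E = closed_segment a b" "E' = closed_segment c a"
    | "E = closed_segment c a" "E' = closed_segment a b"
    using assms(4) by auto
  then show thesis
  proof cases
    case 1
    show thesis
    proof (rule that)
      show "\<not> affine_dependent {a, b, c}" "e = convex hull {a, b, c}"
        by (rule perm, blast)+
      show "distinct [a, b, c]"
        using abc(2) by auto
      show "E = closed_segment b a" "E' = closed_segment b c"
        using 1 by (simp_all add: closed_segment_commute)
    qed
  next
    case 2
    show thesis
    proof (rule that)
      show "\<not> affine_dependent {c, b, a}" "e = convex hull {c, b, a}"
        by (rule perm, blast)+
      show "distinct [c, b, a]"
        using abc(2) by auto
      show "E = closed_segment b c" "E' = closed_segment b a"
        using 2 by (simp_all add: closed_segment_commute)
    qed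
  next
    case 3
    show thesis
    proof (rule that)
      show "\<not> affine_dependent {b, c, a}" "e = convex hull {b, c, a}"
        by (rule perm, blast)+
      show "distinct [b, c, a]"
        using abc(2) by auto
      show "E = closed_segment c b" "E' = closed_segment c a"
        using 3 by (simp_all add: closed_segment_commute)
    qed
  next
    case 4
    show thesis
    proof (rule that)
      show "\<not> affine_dependent {a, c, b}" "e = convex hull {a, c, b}"
        by (rule perm, blast)+
      show "distinct [a, c, b]"
        using abc(2) by auto
      show "E = closed_segment c a" "E' = closed_segment c b"
        using 4 by (simp_all add: closed_segment_commute)
    qed
  next
    case 5
    show thesis
    proof (rule that)
      show "\<not> affine_dependent {b, a, c}" "e = convex hull {b, a, c}"
        by (rule perm, blast)+
      show "distinct [b, a, c]"
        using abc(2) by auto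
      show "E = closed_segment a b" "E' = closed_segment a c"
        using 5 by (simp_all add: closed_segment_commute)
    qed
  next
    case 6
    show thesis
    proof (rule that)
      show "\<not> affine_dependent {c, a, b}" "e = convex hull {c, a, b}"
        by (rule perm, blast)+
      show "distinct [c, a, b]"
        using abc(2) by auto
      show "E = closed_segment a c" "E' = closed_segment a b"
        using 6 by (simp_all add: closed_segment_commute)
    qed
  qed
qed

text \<open>Three edges cannot all equal one set. As \<open>E\<close> is arbitrary, the rule also
  supplies a first edge, not only a second one.\<close>

lemma another_edgeE:
  fixes e :: "'a::euclidean_space set"
  assumes "2 simplex e"
  obtains E' where "E' edge_of e" "E' \<noteq> E"
proof -
  have "\<not> {E. E edge_of e} \<subseteq> {E}"
    using card_edges_of_triangle [OF assms] card_mono [of "{E}" "{E. E edge_of e}"] by auto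
  then show thesis using that by blast
qed

lemma finite_edges_of_triangle:
  fixes e :: "'a::euclidean_space set"
  assumes "2 simplex e"
  shows "finite {E. E edge_of e}"
  using card_edges_of_triangle [OF assms] card.infinite by fastforce

lemma interior_triangle_nonempty:
  fixes e :: "plane set"
  assumes "2 simplex e"
  shows "interior e \<noteq> {}"
proof -
  have "aff_dim e = DIM(plane)"
    using aff_dim_simplex [OF assms] by simp
  then have "rel_interior e = interior e" "e \<noteq> {}"
    using aff_dim_eq_full [of e] rel_interior_interior by auto
  then show ?thesis
    using assms convex_simplex rel_interior_eq_empty by metis
qed

lemma lmeasurable_triangle: "2 simplex e \<Longrightarrow> e \<in> lmeasurable"
  by (auto intro: lmeasurable_compact compact_simplex)

lemma area_triangle_pos:
  assumes "2 simplex e"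
  shows "0 < area e"
proof -
  have "\<not> negligible e"
    using interior_triangle_nonempty [OF assms] negligible_convex_interior convex_simplex assms
    by blast
  then show ?thesis
    using lmeasurable_triangle [OF assms]
    by (auto simp: area_def negligible_iff_measure zero_less_measure_iff)
qed

section \<open>Barycentric sub-triangles\<close>

lemma barycenter_triangle:
  assumes "\<not> affine_dependent {a, b, c}" "distinct [a, b, c]"
  shows "barycenter (convex hull {a, b, c}) = (1/3) *\<^sub>R (a + b + c)"
proof -
  have "{z. z extreme_point_of convex hull {a, b, c}} = {a, b, c}"
    using extreme_point_of_convex_hull_affine_independent [OF assms(1)] by blast
  then show ?thesis
    using assms(2) by (simp add: barycenter_def add.assoc)
qed

text \<open>The contribution of one element to a smoothing domain; intended for edges
  \<open>E\<close> of \<open>e\<close>.\<close>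

definition sub_triangle :: "plane set \<Rightarrow> plane set \<Rightarrow> plane set" where
  "sub_triangle e E = convex hull (insert (barycenter e) E)"

lemma sub_triangle_eq:
  assumes "\<not> affine_dependent {a, b, c}" "distinct [a, b, c]"
  shows "sub_triangle (convex hull {a, b, c}) (closed_segment a b) =
    convex hull {(1/3) *\<^sub>R (a + b + c), a, b}"
  unfolding sub_triangle_def barycenter_triangle [OF assms] segment_convex_hull
  by (metis hull_insert)

lemma sub_triangle_subset:
  assumes "2 simplex e" "E edge_of e"
  shows "sub_triangle e E \<subseteq> e"
proof -
  obtain E' where E': "E' edge_of e" "E' \<noteq> E"
    using another_edgeE [OF assms(1)] .
  obtain a b c where abc: "\<not> affine_dependent {a, b, c}" "distinct [a, b, c]"
      "e = convex hull {a, b, c}" "E = closed_segment b a"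
    using two_edgesE [OF assms(1,2) E'(1)] E'(2) by metis
  have "(1/3) *\<^sub>R (a + b + c) \<in> convex hull {a, b, c}"
    unfolding convex_hull_3
    by (intro CollectI exI [of _ "1/3"]) (simp add: algebra_simps)
  then have "barycenter e \<in> e"
    using barycenter_triangle [OF abc(1,2)] abc(3) by simp
  moreover have "E \<subseteq> e"
    using assms(2) edge_of_imp_subset by blast
  moreover have "convex e"
    using assms(1) convex_simplex by blast
  ultimately show ?thesis
    unfolding sub_triangle_def by (intro hull_minimal) auto
qed

lemma compact_convex_sub_triangle:
  assumes "2 simplex e" "E edge_of e"
  shows "compact (sub_triangle e E)" "convex (sub_triangle e E)"
proof -
  have "compact E"
    using assms face_of_imp_compact compact_simplex convex_simplex unfolding edge_of_def by metis
  then show "compact (sub_triangle e E)"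
    unfolding sub_triangle_def by (simp add: compact_convex_hull compact_insert)
  show "convex (sub_triangle e E)"
    unfolding sub_triangle_def by simp
qed

text \<open>Over a given edge, the barycenter has a third of the height of the opposite vertex. In
  the determinant formula for the area, replacing that vertex by the barycenter divides the
  determinant by three.\<close>

lemma area_sub_triangle:
  assumes "2 simplex e" "E edge_of e"
  shows "area (sub_triangle e E) = area e / 3"
proof -
  obtain E' where E': "E' edge_of e" "E' \<noteq> E"
    using another_edgeE [OF assms(1)] .
  obtain a b c where abc: "\<not> affine_dependent {a, b, c}" "distinct [a, b, c]"
      "e = convex hull {a, b, c}" "E = closed_segment a b"
    using two_edgesE [OF assms(1,2) E'(1)] E'(2) by (metis closed_segment_commute)
  \<comment> \<open>The determinant formula concerns \<open>lborel\<close>, which agrees with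
    \<open>lebesgue\<close> on compact sets.\<close>
  have area: "area (convex hull {x, y, z}) = measure lborel (convex hull {x, y, z})" for x y z
    unfolding area_def
    by (intro measure_completion) (simp add: borel_compact finite_imp_compact_convex_hull)
  have "area (sub_triangle e E) = measure lborel (convex hull {a, b, (1/3) *\<^sub>R (a + b + c)})"
    unfolding abc(3,4) sub_triangle_eq [OF abc(1,2)] area by (simp add: insert_commute)
  also have "\<dots> = \<bar>(c $ 1 - a $ 1) * (b $ 2 - a $ 2) - (b $ 1 - a $ 1) * (c $ 2 - a $ 2)\<bar> / 2 / 3"
  proof -
    have "(((1/3) *\<^sub>R (a + b + c)) $ 1 - a $ 1) * (b $ 2 - a $ 2) -
        (b $ 1 - a $ 1) * (((1/3) *\<^sub>R (a + b + c)) $ 2 - a $ 2) =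
      ((c $ 1 - a $ 1) * (b $ 2 - a $ 2) - (b $ 1 - a $ 1) * (c $ 2 - a $ 2)) / 3"
      by (simp add: field_simps)
    then show ?thesis unfolding content_triangle by (simp only: abs_divide abs_numeral)
  qed
  also have "\<dots> = area e / 3"
    unfolding abc(3) area content_triangle ..
  finally show ?thesis .
qed

text \<open>The line through the common vertex and the barycenter separates the two subtriangles.\<close>

lemma negligible_Int_sub_triangles:
  assumes "2 simplex e" "E edge_of e" "E' edge_of e" "E \<noteq> E'"
  shows "negligible (sub_triangle e E \<inter> sub_triangle e E')"
proof -
  obtain a b c where abc: "\<not> affine_dependent {a, b, c}" "distinct [a, b, c]"
      "e = convex hull {a, b, c}" "E = closed_segment b a" "E' = closed_segment b c"
    using two_edgesE [OF assms] .
  define m where "m = (1/3) *\<^sub>R (a + b + c)"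
  \<comment> \<open>\<open>n\<close> is normal to the separating line through \<open>b\<close> and
    \<open>m\<close>; signs of \<open>n \<bullet> (x - b)\<close> tell its two sides apart.\<close>
  obtain n where n: "n \<noteq> 0" "n \<bullet> (m - b) = 0"
    using orthogonal_to_vector_exists [of "m - b"]
    by (auto simp: orthogonal_def inner_commute)
  \<comment> \<open>As \<open>m\<close> is the barycenter, the two edge vectors at \<open>b\<close>
    sum to a multiple of \<open>m - b\<close>, which \<open>n\<close> annihilates. So
    \<open>a\<close> and \<open>c\<close> have opposite signed heights.\<close>
  have opp: "n \<bullet> (c - b) = - (n \<bullet> (a - b))"
  proof -
    have "a - b + (c - b) = 3 *\<^sub>R (m - b)"
      unfolding m_def by (simp add: vec_eq_iff field_simps)
    then have "n \<bullet> (a - b + (c - b)) = n \<bullet> (3 *\<^sub>R (m - b))"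
      by simp
    then have "n \<bullet> (a - b) + n \<bullet> (c - b) = 3 * (n \<bullet> (m - b))"
      unfolding inner_add_right inner_scaleR_right .
    then show ?thesis using n(2) by simp
  qed
  have "\<not> affine_dependent {b, a, c}" "distinct [b, a, c]"
    "\<not> affine_dependent {b, c, a}" "distinct [b, c, a]"
    using abc(1,2) by (auto simp: insert_commute)
  note sub_triangle_eq [OF this(1,2)] sub_triangle_eq [OF this(3,4)]
  moreover have "convex hull {b, a, c} = e" "convex hull {b, c, a} = e"
    unfolding abc(3) by (simp_all add: insert_commute)
  moreover have "(1/3) *\<^sub>R (b + a + c) = m" "(1/3) *\<^sub>R (b + c + a) = m"
    unfolding m_def by (simp_all add: add_ac)
  ultimately have eqs: "sub_triangle e E = convex hull {m, b, a}"
      "sub_triangle e E' = convex hull {m, b, c}"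
    using abc(4,5) by simp_all
  have coord: "\<exists>w\<ge>0. n \<bullet> (x - b) = w * (n \<bullet> (d - b))" if x: "x \<in> convex hull {m, b, d}" for x d
  proof -
    obtain p q r where pqr: "0 \<le> p" "0 \<le> q" "0 \<le> r" "p + q + r = 1"
      "x = p *\<^sub>R m + q *\<^sub>R b + r *\<^sub>R d"
      using x unfolding convex_hull_3 by blast
    have q: "q = 1 - p - r" using pqr(4) by linarith
    have "x - b = p *\<^sub>R (m - b) + r *\<^sub>R (d - b)"
      unfolding pqr(5) q by (simp add: algebra_simps)
    then have "n \<bullet> (x - b) = p * (n \<bullet> (m - b)) + r * (n \<bullet> (d - b))"
      by (simp only: inner_add_right inner_scaleR_right)
    then have "n \<bullet> (x - b) = r * (n \<bullet> (d - b))"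
      unfolding n(2) by simp
    then show ?thesis using pqr(3) by blast
  qed
  have "sub_triangle e E \<inter> sub_triangle e E' \<subseteq> {x. n \<bullet> x = n \<bullet> b}"
  proof
    fix x assume "x \<in> sub_triangle e E \<inter> sub_triangle e E'"
    then have x: "x \<in> convex hull {m, b, a}" "x \<in> convex hull {m, b, c}"
      using eqs by auto
    obtain v where v: "v \<ge> 0" "n \<bullet> (x - b) = v * (n \<bullet> (a - b))"
      using coord [OF x(1)] by blast
    obtain w where w: "w \<ge> 0" "n \<bullet> (x - b) = w * (n \<bullet> (c - b))"
      using coord [OF x(2)] by blast
    have "(v + w) * (n \<bullet> (a - b)) = v * (n \<bullet> (a - b)) - w * (n \<bullet> (c - b))"
      unfolding opp by (simp only: distrib_right mult_minus_right diff_minus_eq_add)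
    also have "\<dots> = 0"
      unfolding v(2) [symmetric] w(2) [symmetric] by simp
    \<comment> \<open>Either alternative gives \<open>x\<close> height zero, so the two can be
      treated together.\<close>
    finally have "v = 0 \<or> n \<bullet> (a - b) = 0"
      using v(1) w(1) by (simp only: mult_eq_0_iff add_nonneg_eq_0_iff) blast
    then have "n \<bullet> (x - b) = 0"
      unfolding v(2) by simp
    then show "x \<in> {x. n \<bullet> x = n \<bullet> b}"
      by (simp add: inner_diff_right)
  qed
  then show ?thesis
    using negligible_hyperplane [of n] n(1) negligible_subset by blast
qed

text \<open>The linear map given by \<open>g\<close> varies by \<open>2 * r * norm g\<close> across
  the ball. Two points of the triangle differ by a combination of the edge vectors at
  \<open>b\<close> with coefficients of modulus at most one. This quantifies that the two edge
  directions span the space of gradients.\<close>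

lemma norm_le_of_cball_subset_triangle:
  fixes g :: "'a::euclidean_space"
  assumes "cball z r \<subseteq> convex hull {a, b, c}" "0 < r"
  shows "2 * r * norm g \<le> \<bar>g \<bullet> (a - b)\<bar> + \<bar>g \<bullet> (c - b)\<bar>"
proof (cases "g = 0")
  case False
  \<comment> \<open>The radius in the direction of \<open>g\<close>: the map attains its extrema on
    the ball at \<open>z + d\<close> and \<open>z - d\<close>.\<close>
  define d where "d = (r / norm g) *\<^sub>R g"
  have d: "norm d = r" "g \<bullet> d = r * norm g"
    using False assms(2) by (auto simp: d_def dot_square_norm power2_eq_square)
  have coords: "\<exists>p q. 0 \<le> p \<and> p \<le> 1 \<and> 0 \<le> q \<and> q \<le> 1 \<and> x = b + p *\<^sub>R (a - b) + q *\<^sub>R (c - b)"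
    if "x \<in> cball z r" for x
  proof -
    have "x \<in> convex hull {a, b, c}" using that assms(1) by blast
    then obtain p q s where pqs: "0 \<le> p" "0 \<le> s" "0 \<le> q" "p + s + q = 1"
      "x = p *\<^sub>R a + s *\<^sub>R b + q *\<^sub>R c"
      unfolding convex_hull_3 by blast
    have "s = 1 - p - q" using pqs by simp
    have "x = b + p *\<^sub>R (a - b) + q *\<^sub>R (c - b)"
      unfolding pqs(5) \<open>s = 1 - p - q\<close> by (simp add: algebra_simps)
    then show ?thesis using pqs by (intro exI [of _ p] exI [of _ q]) auto
  qed
  have mem: "z + d \<in> cball z r" "z - d \<in> cball z r"
    using d by (auto simp: dist_norm)
  obtain p q where pq: "0 \<le> p" "p \<le> 1" "0 \<le> q" "q \<le> 1"
    "z + d = b + p *\<^sub>R (a - b) + q *\<^sub>R (c - b)"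
    using coords [OF mem(1)] by blast
  obtain p' q' where pq': "0 \<le> p'" "p' \<le> 1" "0 \<le> q'" "q' \<le> 1"
    "z - d = b + p' *\<^sub>R (a - b) + q' *\<^sub>R (c - b)"
    using coords [OF mem(2)] by blast
  have "2 * r * norm g = g \<bullet> ((z + d) - (z - d))"
    using d by (simp add: inner_add_right flip: mult_2)
  also have "\<dots> = (p - p') * (g \<bullet> (a - b)) + (q - q') * (g \<bullet> (c - b))"
    unfolding pq(5) pq'(5) by (simp add: inner_add_right inner_diff_right algebra_simps)
  also have "\<dots> \<le> \<bar>p - p'\<bar> * \<bar>g \<bullet> (a - b)\<bar> + \<bar>q - q'\<bar> * \<bar>g \<bullet> (c - b)\<bar>"
    unfolding abs_mult [symmetric] by (intro add_mono abs_ge_self)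
  also have "\<dots> \<le> 1 * \<bar>g \<bullet> (a - b)\<bar> + 1 * \<bar>g \<bullet> (c - b)\<bar>"
    using pq pq' by (intro add_mono mult_right_mono) auto
  finally show ?thesis by simp
qed simp

section \<open>Integrals of piecewise constant functions\<close>

text \<open>Off the null set \<open>N\<close> a point lies in at most one piece, so the weighted sum
  of indicators agrees with the integrand almost everywhere. Both energies are evaluated this way,
  with elements and with sub-triangles as pieces.\<close>

lemma set_integral_piecewise_const:
  fixes f :: "'a::euclidean_space \<Rightarrow> real"
  assumes "finite I" and A: "\<And>i. i \<in> I \<Longrightarrow> A i \<in> lmeasurable"
    and disj: "\<And>i j. i \<in> I \<Longrightarrow> j \<in> I \<Longrightarrow> i \<noteq> j \<Longrightarrow> A i \<inter> A j \<subseteq> N"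
    and N: "negligible N"
    and "\<And>i x. i \<in> I \<Longrightarrow> x \<in> A i - N \<Longrightarrow> x \<in> S \<and> f x = c i"
    and "\<And>x. x \<in> S - N - (\<Union>i\<in>I. A i) \<Longrightarrow> f x = 0"
  shows "(LINT x:S|lebesgue. f x) = (\<Sum>i\<in>I. measure lebesgue (A i) * c i)"
proof -
  define F where "F x = (\<Sum>i\<in>I. indicator (A i) x * c i)" for x
  have eq: "F x = indicator S x *\<^sub>R f x" if "x \<notin> N" for x
  proof (cases "\<exists>i\<in>I. x \<in> A i")
    case True
    then obtain i where i: "i \<in> I" "x \<in> A i" by blast
    have "F x = (\<Sum>j\<in>{i}. indicator (A j) x * c j)"
      unfolding F_def
      by (rule sum.mono_neutral_right) (use assms(1) i disj that in \<open>auto simp: indicator_def\<close>)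
    then show ?thesis
      using assms(5) [of i x] i that by simp
  next
    case False
    then have "F x = 0" unfolding F_def by (simp add: indicator_def)
    then show ?thesis
      using assms(6) [of x] False that by (auto simp: indicator_def)
  qed
  have AE: "AE x in lebesgue. F x = indicator S x *\<^sub>R f x"
  proof (rule AE_I')
    show "N \<in> null_sets lebesgue" using N negligible_iff_null_sets by blast
    show "{x \<in> space lebesgue. F x \<noteq> indicator S x *\<^sub>R f x} \<subseteq> N" using eq by blast
  qed
  have int: "integrable lebesgue (\<lambda>x. indicator (A i) x * c i)" if "i \<in> I" for i
    using A [OF that] by (intro integrable_mult_left integrable_real_indicator)
      (auto simp: fmeasurable_def)
  have F: "F \<in> borel_measurable lebesgue"
    unfolding F_def by (intro borel_measurable_sum borel_measurable_integrable int)
  \<comment> \<open>Measurability of the integrand is inherited from \<open>F\<close>: the two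
    differ only on a null set of the complete measure \<open>lebesgue\<close>.\<close>
  have "(LINT x:S|lebesgue. f x) = integral\<^sup>L lebesgue F"
    unfolding set_lebesgue_integral_def
    by (rule integral_cong_AE [OF borel_measurable_AE [OF F AE] F])
      (use AE in \<open>auto elim: eventually_mono\<close>)
  also have "\<dots> = (\<Sum>i\<in>I. measure lebesgue (A i) * c i)"
    unfolding F_def by (subst Bochner_Integration.integral_sum, erule int, simp)
  finally show ?thesis .
qed

section \<open>The two energies on a fixed mesh\<close>

lemma GDERIV_affine_on:
  assumes "\<And>y. y \<in> e \<Longrightarrow> u y = g \<bullet> y + c" "x \<in> interior e"
  shows "GDERIV u x :> g"
proof -
  have "((\<lambda>y. g \<bullet> y + c) has_derivative (\<lambda>h. g \<bullet> h)) (at x)"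
    by (auto intro!: derivative_eq_intros)
  then have "(u has_derivative (\<lambda>h. g \<bullet> h)) (at x)"
    by (rule has_derivative_transform_within_open [of _ _ _ _ "interior e"])
      (use assms(2) assms(1) [OF subsetD [OF interior_subset]] in auto)
  then show ?thesis
    unfolding gderiv_def by (simp add: inner_commute)
qed

lemma GDERIV_unique:
  assumes "GDERIV u x :> g" "GDERIV u x :> g'"
  shows "g = g'"
proof -
  have "h \<bullet> g = h \<bullet> g'" for h
    using fun_cong [OF has_derivative_unique [OF assms [unfolded gderiv_def]]] .
  then show ?thesis
    using vector_eq_ldot by blast
qed

lemma grad_eq: "GDERIV u x :> g \<Longrightarrow> grad u x = g"
  unfolding grad_def by (blast intro: GDERIV_unique)

text \<open>A point in the interior of \<open>e\<close> is what makes the description in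
  \<open>grad_on\<close> unique.\<close>

lemma grad_on_eq:
  assumes "\<And>x. x \<in> interior e \<Longrightarrow> GDERIV u x :> g" "interior e \<noteq> {}"
  shows "grad_on e u = g"
  unfolding grad_on_def using assms by (blast intro: GDERIV_unique)

text \<open>By conformity the intersection is a face of both elements, and a face other than the
  whole element misses its interior.\<close>

lemma elements_disjoint_interior:
  assumes T: "triangulation \<T>" and dim: "\<And>e. e \<in> \<T> \<Longrightarrow> 2 simplex (e :: plane set)"
    and e: "e \<in> \<T>" "e' \<in> \<T>" "e \<noteq> e'"
  shows "e \<inter> e' \<subseteq> frontier e"
proof -
  have faces: "e \<inter> e' face_of e" "e \<inter> e' face_of e'"
    using T e unfolding triangulation_def by (blast, metis Int_commute)
  \<comment> \<open>Otherwise \<open>e\<close> would be a proper face of \<open>e'\<close> and miss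
    the interior of \<open>e'\<close>, although this contains the nonempty interior of
    \<open>e\<close>.\<close>
  have ne: "e \<inter> e' \<noteq> e"
  proof
    assume eq: "e \<inter> e' = e"
    then have "e \<inter> interior e' = {}"
      using face_of_disjoint_interior [of e e'] faces e(3) by auto
    moreover have "interior e \<subseteq> interior e'"
      using eq interior_mono by blast
    ultimately show False
      using interior_triangle_nonempty [OF dim [OF e(1)]] interior_subset by blast
  qed
  have "e \<inter> e' \<inter> interior e = {}"
    using face_of_disjoint_interior [OF faces(1) ne] .
  moreover have "closed e"
    using dim [OF e(1)] closed_simplex by blast
  ultimately show ?thesis
    by (auto simp: frontier_def closure_closed)
qed

section \<open>Null sets and element-edge pairs of a single mesh\<close>

locale triangle_mesh =
  fixes \<Omega> :: "plane set" and \<T> :: "plane set set"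
  assumes domain: "bounded_polygonal_domain \<Omega>" and mesh: "triangulation_of \<T> \<Omega>"
begin

lemma triangulation: "triangulation \<T>"
  and element: "e \<in> \<T> \<Longrightarrow> 2 simplex e"
  and Union_elements: "\<Union>\<T> = closure \<Omega>"
  using mesh by (auto simp: triangulation_of_def)

lemma finite_elements: "finite \<T>"
  using triangulation by (simp add: triangulation_def)

text \<open>Elements lie in the closure of \<Omega>; the condition
  \<open>interior (closure \<Omega>) = \<Omega>\<close> brings their interiors back into the domain
  of integration.\<close>

lemma interior_element_subset: "e \<in> \<T> \<Longrightarrow> interior e \<subseteq> \<Omega>"
  using domain Union_elements interior_mono [of e "closure \<Omega>"]
  unfolding bounded_polygonal_domain_def by blast

lemma element_cases: "e \<in> \<T> \<Longrightarrow> x \<in> e \<Longrightarrow> x \<in> interior e \<or> x \<in> frontier e"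
  using closure_subset by (auto simp: frontier_def)

lemma negligible_frontier_element: "e \<in> \<T> \<Longrightarrow> negligible (frontier e)"
  using element convex_simplex negligible_convex_frontier by blast

definition mesh_null :: "plane set" where
  "mesh_null = (\<Union>e\<in>\<T>. frontier e)"

text \<open>Indexing by pairs splits each smoothing domain into sub-triangles, whose areas are
  known, and allows sums to be grouped by element or by edge.\<close>

definition incidences :: "(plane set \<times> plane set) set" where
  "incidences = Sigma \<T> (\<lambda>e. {E. E edge_of e})"

text \<open>\<open>mesh_null\<close> contains the overlaps of sub-triangles from different elements,
  and the last union those within one element. The frontiers are included because
  \<open>ES_grad\<close> refers to interiors of smoothing domains.\<close>

definition ES_null :: "plane set" where
  "ES_null = mesh_null \<union> (\<Union>(e, E)\<in>incidences. frontier (sub_triangle e E)) \<union>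
     (\<Union>(e, E)\<in>incidences. \<Union>E'\<in>{E'. E' edge_of e} - {E}. sub_triangle e E \<inter> sub_triangle e E')"

lemma finite_incidences: "finite incidences"
  unfolding incidences_def using finite_elements element finite_edges_of_triangle by blast

lemma negligible_mesh_null: "negligible mesh_null"
  unfolding mesh_null_def using finite_elements negligible_frontier_element
  by (blast intro: negligible_Union)

lemma negligible_ES_null: "negligible ES_null"
proof -
  have "negligible (frontier (sub_triangle e E))" if "(e, E) \<in> incidences" for e E
    using that element compact_convex_sub_triangle negligible_convex_frontier
    unfolding incidences_def by blast
  moreover have "negligible (\<Union>E'\<in>{E'. E' edge_of e} - {E}. sub_triangle e E \<inter> sub_triangle e E')"
    if "(e, E) \<in> incidences" for e E
  proof (rule negligible_Union)
    show "finite ((\<lambda>E'. sub_triangle e E \<inter> sub_triangle e E') ` ({E'. E' edge_of e} - {E}))"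
      using that element finite_edges_of_triangle unfolding incidences_def by blast
    show "negligible S"
      if "S \<in> (\<lambda>E'. sub_triangle e E \<inter> sub_triangle e E') ` ({E'. E' edge_of e} - {E})" for S
      using that \<open>(e, E) \<in> incidences\<close> element negligible_Int_sub_triangles
      unfolding incidences_def by blast
  qed
  ultimately show ?thesis
    unfolding ES_null_def using finite_incidences negligible_mesh_null
    by (intro negligible_Un negligible_Union) auto
qed

lemma smoothing_domain_eq:
  "smoothing_domain \<T> E = (\<Union>e\<in>elements_at \<T> E. sub_triangle e E)"
  by (simp add: smoothing_domain_def sub_triangle_def)

lemma sub_triangles_disjoint:
  assumes "(e, E) \<in> incidences" "(e', E') \<in> incidences" "(e, E) \<noteq> (e', E')"
  shows "sub_triangle e E \<inter> sub_triangle e' E' \<subseteq> ES_null"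
proof (cases "e = e'")
  case True
  then have "E' \<in> {E'. E' edge_of e} - {E}"
    using assms unfolding incidences_def by auto
  then show ?thesis using True assms(1) unfolding ES_null_def by blast
next
  case False
  have inT: "e \<in> \<T>" "e' \<in> \<T>" "E edge_of e" "E' edge_of e'"
    using assms by (auto simp: incidences_def)
  have "sub_triangle e E \<inter> sub_triangle e' E' \<subseteq> e \<inter> e'"
    using sub_triangle_subset inT element by blast
  also have "\<dots> \<subseteq> frontier e"
    using elements_disjoint_interior triangulation element inT False by blast
  also have "\<dots> \<subseteq> ES_null"
    unfolding ES_null_def mesh_null_def using inT by blast
  finally show ?thesis .
qed

section \<open>The smoothed gradient and its energy\<close>

lemma finite_edges: "finite (edges \<T>)"
proof -
  have "edges \<T> = snd ` incidences"
    by (force simp: edges_def incidences_def)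
  then show ?thesis using finite_incidences by simp
qed

text \<open>Such a point is interior to the smoothing domain of \<open>E\<close>. If it also lay in
  that of another edge, it would be in an overlap of sub-triangles and hence in
  \<open>ES_null\<close>; so only the summand for \<open>E\<close> survives.\<close>

lemma ES_grad_on_sub_triangle:
  assumes "(e, E) \<in> incidences" "x \<in> sub_triangle e E - ES_null"
  shows "ES_grad \<T> u x = ES_value \<T> u E"
proof -
  have e: "e \<in> \<T>" "E edge_of e"
    using assms(1) by (auto simp: incidences_def)
  then have E: "E \<in> edges \<T>" "e \<in> elements_at \<T> E"
    by (auto simp: edges_def elements_at_def)
  have "x \<in> interior (sub_triangle e E)"
  proof -
    have "x \<notin> frontier (sub_triangle e E)"
      using assms unfolding ES_null_def by blast
    then show ?thesis
      using assms(2) closure_subset unfolding frontier_def by blast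
  qed
  then have int: "x \<in> interior (smoothing_domain \<T> E)"
    using interior_mono [of "sub_triangle e E" "smoothing_domain \<T> E"] E(2)
    unfolding smoothing_domain_eq by blast
  have out: "x \<notin> interior (smoothing_domain \<T> E')" if "E' \<noteq> E" for E'
  proof
    assume "x \<in> interior (smoothing_domain \<T> E')"
    then have "x \<in> smoothing_domain \<T> E'"
      using interior_subset by blast
    then obtain e' where "e' \<in> \<T>" "E' edge_of e'" "x \<in> sub_triangle e' E'"
      unfolding smoothing_domain_eq elements_at_def by blast
    then show False
      using sub_triangles_disjoint [of e E e' E'] assms that by (auto simp: incidences_def)
  qed
  have "ES_grad \<T> u x =
      (\<Sum>E'\<in>{E}. indicator (interior (smoothing_domain \<T> E')) x *\<^sub>R ES_value \<T> u E')"
    unfolding ES_grad_def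
    by (rule sum.mono_neutral_right) (use finite_edges E out in \<open>auto simp: indicator_def\<close>)
  then show ?thesis using int by simp
qed

text \<open>Every indicator in the sum vanishes at such a point, so the rest of \<Omega> contributes
  nothing to the smoothed energy.\<close>

lemma ES_grad_off_sub_triangles:
  assumes "\<And>e E. (e, E) \<in> incidences \<Longrightarrow> x \<notin> sub_triangle e E"
  shows "ES_grad \<T> u x = 0"
proof -
  have "x \<notin> smoothing_domain \<T> E" for E
    using assms unfolding smoothing_domain_eq elements_at_def incidences_def by blast
  then have "x \<notin> interior (smoothing_domain \<T> E)" for E
    using interior_subset by blast
  then show ?thesis
    unfolding ES_grad_def by simp
qed

lemma ES_energy:
  "(LINT x:\<Omega>|lebesgue. ES_grad \<T> u x \<bullet> ES_grad \<T> u x) =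
    (\<Sum>e\<in>\<T>. \<Sum>E | E edge_of e. area e / 3 * (norm (ES_value \<T> u E))\<^sup>2)"
proof -
  have "(LINT x:\<Omega>|lebesgue. ES_grad \<T> u x \<bullet> ES_grad \<T> u x) =
    (\<Sum>i\<in>incidences. measure lebesgue (case i of (e, E) \<Rightarrow> sub_triangle e E) *
      (case i of (e, E) \<Rightarrow> (norm (ES_value \<T> u E))\<^sup>2))"
  proof (rule set_integral_piecewise_const [where N = ES_null])
    show "finite incidences" "negligible ES_null"
      by (rule finite_incidences negligible_ES_null)+
    show "(case i of (e, E) \<Rightarrow> sub_triangle e E) \<in> lmeasurable" if "i \<in> incidences" for i
    proof -
      obtain e E where i: "i = (e, E)" by fastforce
      then have "2 simplex e" "E edge_of e"
        using that element by (auto simp: incidences_def)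
      then show ?thesis
        by (simp add: i lmeasurable_compact compact_convex_sub_triangle)
    qed
    show "(case i of (e, E) \<Rightarrow> sub_triangle e E) \<inter> (case j of (e, E) \<Rightarrow> sub_triangle e E) \<subseteq> ES_null"
      if "i \<in> incidences" "j \<in> incidences" "i \<noteq> j" for i j
      using that sub_triangles_disjoint [of "fst i" "snd i" "fst j" "snd j"]
      by (simp add: case_prod_unfold)
    show "x \<in> \<Omega> \<and> ES_grad \<T> u x \<bullet> ES_grad \<T> u x =
        (case i of (e, E) \<Rightarrow> (norm (ES_value \<T> u E))\<^sup>2)"
      if "i \<in> incidences" "x \<in> (case i of (e, E) \<Rightarrow> sub_triangle e E) - ES_null" for i x
    proof -
      obtain e E where i: "i = (e, E)" by fastforce
      have e: "e \<in> \<T>" "E edge_of e" "x \<in> sub_triangle e E" "x \<notin> ES_null"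
        using that by (auto simp: i incidences_def)
      have "x \<in> e"
        using sub_triangle_subset [OF element [OF e(1)] e(2)] e(3) by blast
      moreover have "x \<notin> frontier e"
        using e(1,4) unfolding ES_null_def mesh_null_def by blast
      ultimately have "x \<in> interior e"
        using element_cases e(1) by blast
      then have "x \<in> \<Omega>"
        using interior_element_subset e(1) by blast
      then show ?thesis
        using that(1) e(3,4) ES_grad_on_sub_triangle [of e E x u] by (simp add: i dot_square_norm)
    qed
    show "ES_grad \<T> u x \<bullet> ES_grad \<T> u x = 0"
      if "x \<in> \<Omega> - ES_null - (\<Union>i\<in>incidences. case i of (e, E) \<Rightarrow> sub_triangle e E)" for x
      using that ES_grad_off_sub_triangles [of x u] by auto
  qed
  also have "\<dots> = (\<Sum>(e, E)\<in>incidences. area e / 3 * (norm (ES_value \<T> u E))\<^sup>2)"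
    by (rule sum.cong)
      (use area_sub_triangle element in \<open>auto simp: incidences_def area_def [symmetric]\<close>)
  also have "\<dots> = (\<Sum>e\<in>\<T>. \<Sum>E | E edge_of e. area e / 3 * (norm (ES_value \<T> u E))\<^sup>2)"
    unfolding incidences_def
    by (rule sum.Sigma [symmetric]) (use finite_elements element finite_edges_of_triangle in auto)
  finally show ?thesis .
qed

section \<open>The standard energy\<close>

lemma V\<^sub>h_affine:
  assumes "u \<in> V\<^sub>h \<Omega> \<T>" "e \<in> \<T>"
  shows "\<exists>c. \<forall>x\<in>e. u x = grad_on e u \<bullet> x + c"
proof -
  obtain g c where gc: "\<And>x. x \<in> e \<Longrightarrow> u x = g \<bullet> x + c"
    using assms by (fastforce simp: V\<^sub>h_def P1_def)
  then have "grad_on e u = g"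
    using grad_on_eq GDERIV_affine_on interior_triangle_nonempty element assms(2) by metis
  then show ?thesis using gc by blast
qed

lemma grad_in_element:
  assumes "u \<in> V\<^sub>h \<Omega> \<T>" "e \<in> \<T>" "x \<in> interior e"
  shows "grad u x = grad_on e u"
  using V\<^sub>h_affine [OF assms(1,2)] GDERIV_affine_on [of e u _ _ x] assms(3) grad_eq by blast

lemma energy:
  assumes "u \<in> V\<^sub>h \<Omega> \<T>"
  shows "(LINT x:\<Omega>|lebesgue. grad u x \<bullet> grad u x) = (\<Sum>e\<in>\<T>. area e * (norm (grad_on e u))\<^sup>2)"
  unfolding area_def
proof (rule set_integral_piecewise_const [where A = "\<lambda>e. e" and N = mesh_null])
  show "finite \<T>" "negligible mesh_null"
    by (rule finite_elements negligible_mesh_null)+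
  show "e \<in> lmeasurable" if "e \<in> \<T>" for e
    using that element lmeasurable_triangle by blast
  show "e \<inter> e' \<subseteq> mesh_null" if "e \<in> \<T>" "e' \<in> \<T>" "e \<noteq> e'" for e e'
    using elements_disjoint_interior [OF triangulation element that] that
    unfolding mesh_null_def by blast
  show "x \<in> \<Omega> \<and> grad u x \<bullet> grad u x = (norm (grad_on e u))\<^sup>2"
    if "e \<in> \<T>" "x \<in> e - mesh_null" for e x
  proof -
    have "x \<in> interior e"
      using that element_cases unfolding mesh_null_def by blast
    then show ?thesis
      using grad_in_element [OF assms that(1)] interior_element_subset [OF that(1)]
      by (auto simp: dot_square_norm)
  qed
  \<comment> \<open>Vacuous, since the elements cover \<Omega>.\<close>
  show "grad u x \<bullet> grad u x = 0" if "x \<in> \<Omega> - mesh_null - (\<Union>e\<in>\<T>. e)" for x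
    using that Union_elements closure_subset by auto
qed

section \<open>Control of the gradient by the smoothed gradient\<close>

lemma finite_elements_at: "finite (elements_at \<T> E)"
  using finite_elements by (simp add: elements_at_def)

lemma elements_at_area_pos: "e \<in> elements_at \<T> E \<Longrightarrow> 0 < area e"
  using element area_triangle_pos by (auto simp: elements_at_def)

lemma sum_area_elements_at_pos: "e \<in> elements_at \<T> E \<Longrightarrow> 0 < (\<Sum>e\<in>elements_at \<T> E. area e)"
  using finite_elements_at elements_at_area_pos by (intro sum_pos) auto

text \<open>On every element at \<open>E\<close> the inner product with the gradient is
  \<open>u a - u b\<close>, and a weighted mean of equal numbers is that number. The element
  \<open>e\<close> guarantees a positive total weight.\<close>

lemma ES_value_tangential:
  assumes u: "u \<in> V\<^sub>h \<Omega> \<T>" and e: "e \<in> elements_at \<T> E" and ab: "a \<in> E" "b \<in> E"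
  shows "ES_value \<T> u E \<bullet> (a - b) = grad_on e u \<bullet> (a - b)"
proof -
  have tang: "grad_on e' u \<bullet> (a - b) = u a - u b" if "e' \<in> elements_at \<T> E" for e'
  proof -
    have "e' \<in> \<T>" "a \<in> e'" "b \<in> e'"
      using that ab edge_of_imp_subset unfolding elements_at_def by blast+
    then show ?thesis
      using V\<^sub>h_affine [OF u, of e'] by (auto simp: inner_diff_right)
  qed
  have "(\<Sum>e\<in>elements_at \<T> E. area e *\<^sub>R grad_on e u) \<bullet> (a - b) =
      (\<Sum>e\<in>elements_at \<T> E. area e) * (u a - u b)"
    by (simp add: inner_sum_left sum_distrib_right tang)
  then show ?thesis
    unfolding ES_value_def using sum_area_elements_at_pos [OF e] tang [OF e] by simp
qed

text \<open>The inscribed ball bounds the gradient by its components along two edges, where it may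
  be replaced by the smoothed values. Edge lengths are at most \<sigma> times the radius, so the
  radius cancels and the constant depends on \<sigma> alone.\<close>

lemma norm_grad_on_le:
  assumes u: "u \<in> V\<^sub>h \<Omega> \<T>" and e: "e \<in> \<T>"
    and ball: "cball z r \<subseteq> e" "0 < r" "diameter e \<le> \<sigma> * r"
  shows "(norm (grad_on e u))\<^sup>2 \<le> \<sigma>\<^sup>2 / 2 * (\<Sum>E | E edge_of e. (norm (ES_value \<T> u E))\<^sup>2)"
proof -
  obtain E where E: "E edge_of e" using another_edgeE [OF element [OF e]] by blast
  obtain E' where E': "E' edge_of e" "E' \<noteq> E" using another_edgeE [OF element [OF e]] by blast
  obtain a b c where abc: "e = convex hull {a, b, c}" "E = closed_segment b a" "E' = closed_segment b c"
    using two_edgesE [OF element [OF e] E E'(1)] E'(2) by metis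
  define g G G' where "g = norm (grad_on e u)"
    and "G = norm (ES_value \<T> u E)" and "G' = norm (ES_value \<T> u E')"
  have at: "e \<in> elements_at \<T> E" "e \<in> elements_at \<T> E'"
    using e E E' by (auto simp: elements_at_def)
  have bound: "\<bar>v \<bullet> (x - b)\<bar> \<le> norm v * (\<sigma> * r)" if "x \<in> {a, c}" for v x
  proof -
    have "x \<in> e" "b \<in> e" using that abc(1) by (auto intro: hull_inc)
    moreover have "bounded e"
      using e element compact_simplex compact_imp_bounded by blast
    ultimately have "norm (x - b) \<le> diameter e"
      using diameter_bounded_bound [of e x b] by (simp add: dist_norm)
    then have "norm v * norm (x - b) \<le> norm v * (\<sigma> * r)"
      using ball(3) by (intro mult_left_mono) auto
    then show ?thesis
      using Cauchy_Schwarz_ineq2 [of v "x - b"] by linarith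
  qed
  have "2 * r * g \<le> \<bar>grad_on e u \<bullet> (a - b)\<bar> + \<bar>grad_on e u \<bullet> (c - b)\<bar>"
    unfolding g_def using norm_le_of_cball_subset_triangle ball(1,2) abc(1) by blast
  also have "\<dots> = \<bar>ES_value \<T> u E \<bullet> (a - b)\<bar> + \<bar>ES_value \<T> u E' \<bullet> (c - b)\<bar>"
    using ES_value_tangential [OF u at(1), of a b] ES_value_tangential [OF u at(2), of c b]
    unfolding abc(2,3) by simp
  also have "\<dots> \<le> G * (\<sigma> * r) + G' * (\<sigma> * r)"
    unfolding G_def G'_def by (intro add_mono bound) auto
  finally have "r * (2 * g) \<le> r * (\<sigma> * (G + G'))"
    by (simp add: algebra_simps)
  then have "2 * g \<le> \<sigma> * (G + G')"
    using ball(2) by simp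
  \<comment> \<open>Squaring and bounding the square of a sum of two terms by twice the sum of
    squares leaves the factor \<open>\<sigma>\<^sup>2 / 2\<close>.\<close>
  then have "(2 * g)\<^sup>2 \<le> (\<sigma> * (G + G'))\<^sup>2"
    by (rule power_mono) (simp add: g_def)
  also have "\<dots> = \<sigma>\<^sup>2 * (G + G')\<^sup>2"
    by (simp add: power_mult_distrib)
  also have "\<dots> \<le> \<sigma>\<^sup>2 * (2 * (G\<^sup>2 + G'\<^sup>2))"
    using sum_squares_bound [of G G']
    by (intro mult_left_mono) (auto simp: power2_sum)
  finally have "g\<^sup>2 \<le> \<sigma>\<^sup>2 / 2 * (G\<^sup>2 + G'\<^sup>2)"
    by (simp add: power_mult_distrib algebra_simps)
  also have "G\<^sup>2 + G'\<^sup>2 = (\<Sum>E\<in>{E, E'}. (norm (ES_value \<T> u E))\<^sup>2)"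
    using E'(2) by (simp add: G_def G'_def)
  also have "\<sigma>\<^sup>2 / 2 * \<dots> \<le> \<sigma>\<^sup>2 / 2 * (\<Sum>E | E edge_of e. (norm (ES_value \<T> u E))\<^sup>2)"
    by (intro mult_left_mono sum_mono2)
      (use E E' finite_edges_of_triangle element e in auto)
  finally show ?thesis unfolding g_def .
qed

text \<open>The estimate on one element is multiplied by its area and summed. The factor 3 appears
  because each edge of an element carries only a third of that area in the smoothed energy.\<close>

lemma energy_le_ES_energy:
  assumes u: "u \<in> V\<^sub>h \<Omega> \<T>"
    and reg: "\<And>e. e \<in> \<T> \<Longrightarrow> \<exists>z r. 0 < r \<and> cball z r \<subseteq> e \<and> diameter e \<le> \<sigma> * r"
  shows "(LINT x:\<Omega>|lebesgue. grad u x \<bullet> grad u x)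
    \<le> 3 * \<sigma>\<^sup>2 / 2 * (LINT x:\<Omega>|lebesgue. ES_grad \<T> u x \<bullet> ES_grad \<T> u x)"
proof -
  have "area e * (norm (grad_on e u))\<^sup>2 \<le>
      3 * \<sigma>\<^sup>2 / 2 * (\<Sum>E | E edge_of e. area e / 3 * (norm (ES_value \<T> u E))\<^sup>2)" if "e \<in> \<T>" for e
  proof -
    obtain z r where "0 < r" "cball z r \<subseteq> e" "diameter e \<le> \<sigma> * r"
      using reg [OF \<open>e \<in> \<T>\<close>] by blast
    then have "(norm (grad_on e u))\<^sup>2 \<le>
        \<sigma>\<^sup>2 / 2 * (\<Sum>E | E edge_of e. (norm (ES_value \<T> u E))\<^sup>2)"
      using norm_grad_on_le u that by blast
    then have "area e * (norm (grad_on e u))\<^sup>2 \<le>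
        area e * (\<sigma>\<^sup>2 / 2 * (\<Sum>E | E edge_of e. (norm (ES_value \<T> u E))\<^sup>2))"
      using area_triangle_pos [OF element [OF that]] by (intro mult_left_mono) auto
    then show ?thesis
      unfolding sum_distrib_left [symmetric] by (simp add: mult_ac)
  qed
  then show ?thesis
    unfolding energy [OF u] ES_energy sum_distrib_left by (rule sum_mono)
qed

section \<open>Control of the smoothed gradient by the gradient\<close>

text \<open>Jensen's inequality for the squared norm, obtained by expanding the nonnegative
  area-weighted variance of the gradients around their mean \<open>G\<close>.\<close>

lemma norm_ES_value_le:
  assumes "e \<in> elements_at \<T> E"
  shows "(\<Sum>e\<in>elements_at \<T> E. area e) * (norm (ES_value \<T> u E))\<^sup>2
    \<le> (\<Sum>e\<in>elements_at \<T> E. area e * (norm (grad_on e u))\<^sup>2)"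
proof -
  define W where "W = (\<Sum>e\<in>elements_at \<T> E. area e)"
  define G where "G = ES_value \<T> u E"
  have W: "W > 0" unfolding W_def using sum_area_elements_at_pos [OF assms] .
  have mean: "(\<Sum>e\<in>elements_at \<T> E. area e *\<^sub>R grad_on e u) = W *\<^sub>R G"
    unfolding G_def ES_value_def W_def [symmetric] using W by simp
  have "0 \<le> (\<Sum>e\<in>elements_at \<T> E. area e * (norm (grad_on e u - G))\<^sup>2)"
    using elements_at_area_pos by (intro sum_nonneg) (simp add: less_imp_le)
  also have "\<dots> = (\<Sum>e\<in>elements_at \<T> E. area e * (norm (grad_on e u))\<^sup>2 -
      2 * ((area e *\<^sub>R grad_on e u) \<bullet> G) + area e * (norm G)\<^sup>2)"
    by (rule sum.cong) (auto simp: power2_norm_eq_inner inner_diff_left inner_diff_right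
        inner_commute algebra_simps)
  \<comment> \<open>The weighted gradients sum to \<open>W *\<^sub>R G\<close>, so the last two
    terms together amount to \<open>- W * (norm G)\<^sup>2\<close>.\<close>
  also have "\<dots> = (\<Sum>e\<in>elements_at \<T> E. area e * (norm (grad_on e u))\<^sup>2) -
      2 * ((W *\<^sub>R G) \<bullet> G) + W * (norm G)\<^sup>2"
  proof -
    have "(\<Sum>e\<in>elements_at \<T> E. 2 * ((area e *\<^sub>R grad_on e u) \<bullet> G)) = 2 * ((W *\<^sub>R G) \<bullet> G)"
      unfolding mean [symmetric] inner_sum_left sum_distrib_left ..
    moreover have "(\<Sum>e\<in>elements_at \<T> E. area e * (norm G)\<^sup>2) = W * (norm G)\<^sup>2"
      unfolding W_def sum_distrib_right ..
    ultimately show ?thesis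
      by (simp only: sum.distrib sum_subtractf)
  qed
  finally show ?thesis
    unfolding W_def [symmetric] G_def [symmetric] by (simp add: power2_norm_eq_inner)
qed

text \<open>Double counting of element-edge pairs: Jensen's inequality acts edge by edge, while the
  energies are sums over elements.\<close>

lemma sum_incidences_swap:
  fixes f :: "plane set \<Rightarrow> plane set \<Rightarrow> real"
  shows "(\<Sum>e\<in>\<T>. \<Sum>E | E edge_of e. f e E) = (\<Sum>E\<in>edges \<T>. \<Sum>e\<in>elements_at \<T> E. f e E)"
proof -
  have "(\<Sum>e\<in>\<T>. \<Sum>E | E edge_of e. f e E) = (\<Sum>e\<in>\<T>. \<Sum>E | E \<in> edges \<T> \<and> E edge_of e. f e E)"
    by (intro sum.cong) (auto simp: edges_def)
  then show ?thesis
    unfolding elements_at_def using sum.swap_restrict [OF finite_elements finite_edges] by simp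
qed

lemma ES_energy_le_energy:
  assumes u: "u \<in> V\<^sub>h \<Omega> \<T>"
  shows "(LINT x:\<Omega>|lebesgue. ES_grad \<T> u x \<bullet> ES_grad \<T> u x)
    \<le> (LINT x:\<Omega>|lebesgue. grad u x \<bullet> grad u x)"
proof -
  have "(\<Sum>e\<in>\<T>. \<Sum>E | E edge_of e. area e / 3 * (norm (ES_value \<T> u E))\<^sup>2) =
      (\<Sum>E\<in>edges \<T>. (\<Sum>e\<in>elements_at \<T> E. area e) * (norm (ES_value \<T> u E))\<^sup>2 / 3)"
    unfolding sum_incidences_swap
    by (simp add: sum_distrib_right sum_divide_distrib)
  also have "\<dots> \<le> (\<Sum>E\<in>edges \<T>. (\<Sum>e\<in>elements_at \<T> E. area e * (norm (grad_on e u))\<^sup>2) / 3)"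
  proof (intro sum_mono divide_right_mono)
    fix E assume "E \<in> edges \<T>"
    then obtain e where "e \<in> elements_at \<T> E"
      by (auto simp: edges_def elements_at_def)
    then show "(\<Sum>e\<in>elements_at \<T> E. area e) * (norm (ES_value \<T> u E))\<^sup>2
        \<le> (\<Sum>e\<in>elements_at \<T> E. area e * (norm (grad_on e u))\<^sup>2)"
      by (rule norm_ES_value_le)
  qed simp
  also have "\<dots> = (\<Sum>e\<in>\<T>. \<Sum>E | E edge_of e. area e * (norm (grad_on e u))\<^sup>2 / 3)"
    unfolding sum_incidences_swap by (simp add: sum_divide_distrib)
  \<comment> \<open>The three edges of each element cancel the factor one third, which makes the
    upper constant equal to 1.\<close>
  also have "\<dots> = (\<Sum>e\<in>\<T>. area e * (norm (grad_on e u))\<^sup>2)"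
    by (rule sum.cong) (use card_edges_of_triangle element in auto)
  finally show ?thesis
    unfolding energy [OF u] ES_energy .
qed

end

section \<open>Spectral equivalence with constants uniform over the family of meshes\<close>

theorem theorem3p2:
  fixes \<Omega> :: "plane set"
    and H :: "real set"
    and \<T> :: "real \<Rightarrow> plane set set"
    and K K\<^sub>E\<^sub>S :: "real \<Rightarrow> plane \<Rightarrow> plane \<Rightarrow> real"
  assumes domain: "bounded_polygonal_domain \<Omega>"
    and mesh_sizes: "\<And>h. h \<in> H \<Longrightarrow> 0 < h"
    and meshes: "\<And>h. h \<in> H \<Longrightarrow> triangulation_of (\<T> h) \<Omega>"
    and quasi_uniform: "quasi_uniform H \<T>"
    and K: "\<And>h. h \<in> H \<Longrightarrow> stiffness_matrix \<Omega> (\<T> h) (K h)"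
    and K\<^sub>E\<^sub>S: "\<And>h. h \<in> H \<Longrightarrow> ES_stiffness_matrix \<Omega> (\<T> h) (K\<^sub>E\<^sub>S h)"
  shows "\<exists>C1>0. \<exists>C2>0. \<forall>h\<in>H. \<forall>u\<in>V\<^sub>h \<Omega> (\<T> h).
           C1 * mat_form \<Omega> (\<T> h) (K h) u u \<le> mat_form \<Omega> (\<T> h) (K\<^sub>E\<^sub>S h) u u \<and>
           mat_form \<Omega> (\<T> h) (K\<^sub>E\<^sub>S h) u u \<le> C2 * mat_form \<Omega> (\<T> h) (K h) u u"
proof -
  \<comment> \<open>A single \<sigma> serves all meshes, being fixed before \<open>h\<close>; this
    is the source of the independence of \<open>h\<close>.\<close>
  obtain \<sigma> where \<sigma>: "\<sigma> > 0"
    and reg: "\<And>h e. h \<in> H \<Longrightarrow> e \<in> \<T> h \<Longrightarrow> \<exists>z r. 0 < r \<and> cball z r \<subseteq> e \<and> diameter e \<le> \<sigma> * r"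
    using quasi_uniform unfolding quasi_uniform_def shape_regular_def by blast
  \<comment> \<open>The lower constant is the reciprocal of the factor in
    \<open>energy_le_ES_energy\<close>; the upper one is the 1 of
    \<open>ES_energy_le_energy\<close>.\<close>
  have "2 / (3 * \<sigma>\<^sup>2) * mat_form \<Omega> (\<T> h) (K h) u u \<le> mat_form \<Omega> (\<T> h) (K\<^sub>E\<^sub>S h) u u \<and>
      mat_form \<Omega> (\<T> h) (K\<^sub>E\<^sub>S h) u u \<le> 1 * mat_form \<Omega> (\<T> h) (K h) u u"
    if h: "h \<in> H" and u: "u \<in> V\<^sub>h \<Omega> (\<T> h)" for h u
  proof -
    interpret triangle_mesh \<Omega> "\<T> h"
      by unfold_locales (use domain meshes h in auto)
    have eqs: "mat_form \<Omega> (\<T> h) (K h) u u = (LINT x:\<Omega>|lebesgue. grad u x \<bullet> grad u x)"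
      "mat_form \<Omega> (\<T> h) (K\<^sub>E\<^sub>S h) u u =
        (LINT x:\<Omega>|lebesgue. ES_grad (\<T> h) u x \<bullet> ES_grad (\<T> h) u x)"
      using K [OF h] K\<^sub>E\<^sub>S [OF h] u
      unfolding stiffness_matrix_def ES_stiffness_matrix_def by blast+
    show ?thesis
      using energy_le_ES_energy [OF u reg [OF h]] ES_energy_le_energy [OF u] \<sigma>
      unfolding eqs by (simp add: field_simps)
  qed
  moreover have "0 < 2 / (3 * \<sigma>\<^sup>2)"
    using \<sigma> by simp
  ultimately show ?thesis
    using zero_less_one by blast
qed

end
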